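(* For $\ell>0$ let $T_\ell$ be the ternary Cantor set of length $\ell$ and define \[p(\ell):=\frac12\sum_{i=-\infty}^{\infty}2^i\tanh\left(\frac{\ell}{2\cdot 3^i}\right),\qquad q_2(\ell):=1-\frac12\sum_{i=0}^{\infty}\frac1{2^i}\tanh\left(\frac{3^i\ell}{2}\right).\] Then: (1) $|T_\ell|=p(\ell)+q_2(\ell)$ for all $\ell>0$; (2) $p(3\ell)=2p(\ell)$ for all $\ell>0$; (3) $q_2(\ell)\to 0$ as $\ell\to\infty$; (4) the functions $p,q_2\colon\mathbb R_{>0}\to\mathbb R$ are uniquely determined by properties (1), (2) and (3).
   Context: A weighting on a finite metric space $(W,d)$ is a choice of real number $w_x$ for each $x\in W$ such that $\sum_{x'\in W} e^{-d(x,x')}w_{x'}=1$ for every $x\in W$. If a weighting exists, the magnitude of $W$ is $|W| := \sum_{x\in W} w_x$; this is independent of the choice of weighting. A metric space $X$ is positive definite if for every finite subspace $W\subseteq X$ the matrix $(e^{-d(x,x')})_{x,x'\in W}$ is positive definite; subspaces of Euclidean space are positive definite, and finite positive definite spaces have a well-defined magnitude. The magnitude of a compact positive definite metric space $X$ is defined as $|X| := \sup\{|W| : W\subseteq X\text{ finite}\}$; equivalently (a result of Meckes), $|X|=\lim_{k}|X_k|$ for any sequence $(X_k)$ of finite subsets of $X$ converging to $X$ in the Hausdorff metric. The ternary Cantor set $T_\ell\subset\mathbb R$ of length $\ell$ is the standard middle-third Cantor set constructed from a closed interval of length $\ell$ (repeatedly removing open middle thirds), with the subspace metric from $\mathbb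 R$; taking the interval to be $[0,\ell]$, it is the unique non-empty compact set with $T_\ell=\psi_1(T_\ell)\cup\psi_2(T_\ell)$, where $\psi_1(x)=x/3$, $\psi_2(x)=x/3+2\ell/3$. All the infinite sums in the definitions of $p$ and $q_2$ converge. *)

theory Defs
  imports "HOL-Analysis.Analysis"
begin

section \<open>Magnitude\<close>

text \<open>A subset of a type of class \<open>metric_space\<close> is regarded as a metric space with the
  restricted distance.\<close>

definition is_weighting :: "'a::metric_space set \<Rightarrow> ('a \<Rightarrow> real) \<Rightarrow> bool" where
  "is_weighting W w \<longleftrightarrow> (\<forall>x\<in>W. (\<Sum>y\<in>W. exp (- dist x y) * w y) = 1)"

definition positive_definite :: "'a::metric_space set \<Rightarrow> bool" where
  "positive_definite X \<longleftrightarrow>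
     (\<forall>W c. finite W \<and> W \<subseteq> X \<and> (\<exists>x\<in>W. c x \<noteq> 0) \<longrightarrow>
        (\<Sum>x\<in>W. \<Sum>y\<in>W. c x * exp (- dist x y) * c y) > 0)"

text \<open>Meaningful for finite sets that have a weighting; the value does not depend on the
  weighting, see \<open>finite_magnitude_eq\<close> below.\<close>

definition finite_magnitude :: "'a::metric_space set \<Rightarrow> real" where
  "finite_magnitude W = (THE m. \<exists>w. is_weighting W w \<and> m = (\<Sum>x\<in>W. w x))"

text \<open>The magnitude of a compact positive definite space. The supremum is taken in the extended
  reals, since it need not be finite in general. The empty subspace contributes the value 0.\<close>

definition magnitude :: "'a::metric_space set \<Rightarrow> ereal" where
  "magnitude X = (SUP W\<in>{W. finite W \<and> W \<subseteq> X}. ereal (finite_magnitude W))"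

lemma finite_magnitude_eq:
  assumes "is_weighting W w"
  shows "finite_magnitude W = (\<Sum>x\<in>W. w x)"
  unfolding finite_magnitude_def
proof (rule the_equality)
  show "\<exists>v. is_weighting W v \<and> (\<Sum>x\<in>W. w x) = (\<Sum>x\<in>W. v x)"
    using assms by blast
next
  fix m assume "\<exists>v. is_weighting W v \<and> m = (\<Sum>x\<in>W. v x)"
  then obtain v where v: "is_weighting W v" and m: "m = (\<Sum>x\<in>W. v x)" by blast
  have "(\<Sum>x\<in>W. v x) = (\<Sum>x\<in>W. v x * (\<Sum>y\<in>W. exp (- dist x y) * w y))"
    using assms by (intro sum.cong) (auto simp: is_weighting_def)
  also have "\<dots> = (\<Sum>x\<in>W. \<Sum>y\<in>W. exp (- dist x y) * v x * w y)"
    by (simp add: sum_distrib_left mult_ac)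
  also have "\<dots> = (\<Sum>y\<in>W. \<Sum>x\<in>W. exp (- dist x y) * v x * w y)"
    by (rule sum.swap)
  also have "\<dots> = (\<Sum>y\<in>W. w y * (\<Sum>x\<in>W. exp (- dist y x) * v x))"
    by (simp add: sum_distrib_left mult_ac dist_commute)
  also have "\<dots> = (\<Sum>y\<in>W. w y)"
    using v by (intro sum.cong) (auto simp: is_weighting_def)
  finally show "m = (\<Sum>x\<in>W. w x)" using m by simp
qed

lemma exp_dist_insert_real:
  fixes x y z :: real
  assumes "x \<le> y" "y \<le> z"
  shows "exp (- dist x z) = exp (- dist x y) * exp (- dist y z)"
  using assms by (simp add: dist_real_def flip: exp_add)

lemma exists_weighting_real:
  fixes W :: "real set"
  assumes "finite W"
  shows "\<exists>w. is_weighting W w"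
  using assms
proof (induction W rule: finite_linorder_max_induct)
  case empty
  show ?case by (simp add: is_weighting_def)
next
  case (insert m W)
  then obtain w where w: "is_weighting W w" by blast
  show ?case
  proof (cases "W = {}")
    case True
    then show ?thesis by (intro exI[of _ "\<lambda>_. 1"]) (simp add: is_weighting_def)
  next
    case False
    define M where "M = Max W"
    have M: "M \<in> W" "\<And>x. x \<in> W \<Longrightarrow> x \<le> M"
      using insert False by (auto simp: M_def)
    have Mm: "M < m" and mW: "m \<notin> W" using insert M by auto
    define r where "r = exp (- dist M m)"
    have r: "0 < r" "r < 1" using Mm by (auto simp: r_def dist_real_def)
    define t where "t = 1 / (1 + r)"
    have t: "t + r * t = 1" using r by (simp add: t_def field_simps)
    have rt: "r * (1 - r * t) + t = 1"
      using t by algebra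
    define v where "v = (\<lambda>x. if x = m then t else if x = M then w M - r * t else w x)"
    have split: "(\<Sum>y\<in>W. exp (- dist x y) * v y)
        = (\<Sum>y\<in>W. exp (- dist x y) * w y) - exp (- dist x M) * (r * t)" for x
    proof -
      have "(\<Sum>y\<in>W. exp (- dist x y) * v y)
        = (\<Sum>y\<in>W. exp (- dist x y) * w y - (if y = M then exp (- dist x M) * (r * t) else 0))"
        using mW by (intro sum.cong) (auto simp: v_def algebra_simps)
      then show ?thesis using M insert by (simp add: sum_subtractf)
    qed
    have eqW: "(\<Sum>y\<in>insert m W. exp (- dist x y) * v y) = 1" if "x \<in> W" for x
    proof -
      have "exp (- dist x m) = exp (- dist x M) * r"
        using exp_dist_insert_real[of x M m] M(2)[OF that] Mm by (simp add: r_def)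
      moreover have "(\<Sum>y\<in>W. exp (- dist x y) * w y) = 1"
        using w that by (simp add: is_weighting_def)
      moreover have "v m = t" by (simp add: v_def)
      moreover have "(\<Sum>y\<in>insert m W. exp (- dist x y) * v y)
          = exp (- dist x m) * v m + (\<Sum>y\<in>W. exp (- dist x y) * v y)"
        using insert.hyps(1) mW by (rule sum.insert)
      ultimately show ?thesis by (simp add: split)
    qed
    have "(\<Sum>y\<in>W. exp (- dist m y) * w y) = (\<Sum>y\<in>W. r * (exp (- dist M y) * w y))"
    proof (rule sum.cong)
      fix y assume "y \<in> W"
      then have "exp (- dist m y) = r * exp (- dist M y)"
        using exp_dist_insert_real[of y M m] M(2) Mm by (simp add: r_def dist_commute)
      then show "exp (- dist m y) * w y = r * (exp (- dist M y) * w y)" by (simp only: mult_ac)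
    qed simp
    also have "\<dots> = r" using w M by (simp add: is_weighting_def flip: sum_distrib_left)
    finally have "(\<Sum>y\<in>insert m W. exp (- dist m y) * v y) = 1"
      using mW insert rt by (simp add: split) (simp add: v_def r_def dist_commute algebra_simps)
    with eqW have "is_weighting (insert m W) v" by (auto simp: is_weighting_def)
    then show ?thesis by blast
  qed
qed

lemma positive_definite_real: "positive_definite (X :: real set)"
proof -
  let ?Q = "\<lambda>W c. \<Sum>x\<in>W. \<Sum>y\<in>W. c x * exp (- dist x y) * c y :: real"
  have "\<forall>c. (\<exists>x\<in>W. c x \<noteq> 0) \<longrightarrow> ?Q W c > 0" if "finite W" for W :: "real set"
    using that
  proof (induction W rule: finite_linorder_max_induct)
    case empty
    show ?case by simp
  next
    case (insert m W)
    show ?case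
    proof (intro allI impI)
      fix c :: "real \<Rightarrow> real"
      assume nz: "\<exists>x\<in>insert m W. c x \<noteq> 0"
      have mW: "m \<notin> W" using insert by auto
      show "?Q (insert m W) c > 0"
      proof (cases "W = {}")
        case True
        then show ?thesis using nz
          by (simp add: power2_eq_square[symmetric])
      next
        case False
        define M where "M = Max W"
        have M: "M \<in> W" "\<And>x. x \<in> W \<Longrightarrow> x \<le> M"
          using insert False by (auto simp: M_def)
        have Mm: "M < m" using insert M by auto
        define r where "r = exp (- dist M m)"
        have r: "0 < r" "r < 1" using Mm by (auto simp: r_def dist_real_def)
        define a where "a = r * c m"
        define d where "d = (\<lambda>x. c x + (if x = M then a else 0))"
        define S where "S = (\<Sum>x\<in>W. c x * exp (- dist x M))"
        have S': "(\<Sum>x\<in>W. exp (- dist M x) * c x) = S"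
          unfolding S_def by (simp add: dist_commute mult.commute)
        have inner: "(\<Sum>y\<in>W. d x * exp (- dist x y) * d y)
           = (\<Sum>y\<in>W. d x * exp (- dist x y) * c y) + d x * exp (- dist x M) * a" for x
        proof -
          have "(\<Sum>y\<in>W. d x * exp (- dist x y) * d y)
             = (\<Sum>y\<in>W. d x * exp (- dist x y) * c y + (if y = M then d x * exp (- dist x M) * a else 0))"
            by (intro sum.cong) (auto simp: d_def algebra_simps)
          then show ?thesis using M insert by (simp add: sum.distrib)
        qed
        have outer: "(\<Sum>x\<in>W. d x * f x) = (\<Sum>x\<in>W. c x * f x) + a * f M" for f :: "real \<Rightarrow> real"
        proof -
          have "(\<Sum>x\<in>W. d x * f x) = (\<Sum>x\<in>W. c x * f x + (if x = M then a * f M else 0))"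
            by (intro sum.cong) (auto simp: d_def algebra_simps)
          then show ?thesis using M insert by (simp add: sum.distrib)
        qed
        have "?Q W d = (\<Sum>x\<in>W. d x * ((\<Sum>y\<in>W. exp (- dist x y) * c y) + exp (- dist x M) * a))"
          unfolding inner by (simp only: distrib_left sum_distrib_left mult.assoc)
        also have "\<dots> = (\<Sum>x\<in>W. c x * ((\<Sum>y\<in>W. exp (- dist x y) * c y) + exp (- dist x M) * a))
            + a * (S + a)"
          unfolding outer S' by simp
        also have "(\<Sum>x\<in>W. c x * ((\<Sum>y\<in>W. exp (- dist x y) * c y) + exp (- dist x M) * a))
            = ?Q W c + S * a"
        proof -
          have "c x * ((\<Sum>y\<in>W. exp (- dist x y) * c y) + exp (- dist x M) * a)
              = (\<Sum>y\<in>W. c x * exp (- dist x y) * c y) + c x * exp (- dist x M) * a" for x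
            by (simp only: distrib_left sum_distrib_left mult.assoc)
          then show ?thesis unfolding S_def by (simp add: sum.distrib sum_distrib_right)
        qed
        finally have Qd: "?Q W d = ?Q W c + 2 * a * S + a\<^sup>2"
          by (simp add: power2_eq_square algebra_simps)
        have mS: "(\<Sum>x\<in>W. c x * exp (- dist x m)) = r * S"
          unfolding S_def sum_distrib_left
        proof (rule sum.cong)
          fix x assume "x \<in> W"
          then have "exp (- dist x m) = exp (- dist x M) * r"
            using exp_dist_insert_real[of x M m] M(2) Mm by (simp add: r_def)
          then show "c x * exp (- dist x m) = r * (c x * exp (- dist x M))"
            by (simp only: mult_ac)
        qed simp
        have "?Q (insert m W) c
            = c m * c m + (\<Sum>y\<in>W. c m * exp (- dist m y) * c y)
              + ((\<Sum>x\<in>W. c x * exp (- dist x m) * c m) + ?Q W c)"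
          using insert mW by (simp add: sum.distrib)
        also have "(\<Sum>x\<in>W. c x * exp (- dist x m) * c m) = c m * (r * S)"
          unfolding mS[symmetric] sum_distrib_left by (simp only: mult_ac)
        also have "(\<Sum>y\<in>W. c m * exp (- dist m y) * c y) = c m * (r * S)"
          unfolding mS[symmetric] sum_distrib_left by (simp only: mult_ac dist_commute)
        finally have Q: "?Q (insert m W) c = ?Q W d + (c m)\<^sup>2 * (1 - r\<^sup>2)"
          unfolding Qd a_def by (simp add: power2_eq_square algebra_simps)
        have r2: "0 < 1 - r\<^sup>2" using r by (simp add: power_less_one_iff)
        have pos: "0 \<le> ?Q W d"
        proof (cases "\<exists>x\<in>W. d x \<noteq> 0")
          case True
          then show ?thesis using insert.IH by (auto intro: less_imp_le)
        next
          case False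
          then show ?thesis by simp
        qed
        show ?thesis
        proof (cases "c m = 0")
          case True
          then have "d = c" by (auto simp: d_def a_def)
          then show ?thesis using Q True nz insert.IH by auto
        next
          case False
          then have "0 < (c m)\<^sup>2 * (1 - r\<^sup>2)" using r2 by simp
          then show ?thesis using Q pos by linarith
        qed
      qed
    qed
  qed
  then show ?thesis unfolding positive_definite_def by blast
qed


section \<open>The ternary Cantor set\<close>

text \<open>\<open>middle_thirds n a b\<close> is what remains of the interval \<open>[a, b]\<close> after \<open>n\<close> rounds of removing
  open middle thirds.\<close>

fun middle_thirds :: "nat \<Rightarrow> real \<Rightarrow> real \<Rightarrow> real set" where
  "middle_thirds 0 a b = {a..b}"
| "middle_thirds (Suc n) a b =
     middle_thirds n a (a + (b - a) / 3) \<union> middle_thirds n (b - (b - a) / 3) b"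

definition cantor_set :: "real \<Rightarrow> real set" where
  "cantor_set l = (\<Inter>n. middle_thirds n 0 l)"

lemma middle_thirds_affine:
  assumes "c > 0"
  shows "middle_thirds n (c * a + d) (c * b + d) = (\<lambda>x. c * x + d) ` middle_thirds n a b"
proof (induction n arbitrary: a b)
  case 0
  show ?case using assms by (simp add: image_affinity_atLeastAtMost)
next
  case (Suc n)
  have "c * a + d + (c * b + d - (c * a + d)) / 3 = c * (a + (b - a) / 3) + d"
    and "c * b + d - (c * b + d - (c * a + d)) / 3 = c * (b - (b - a) / 3) + d"
    by (simp_all add: field_simps)
  then show ?case by (simp only: middle_thirds.simps Suc.IH image_Un)
qed

lemma middle_thirds_Suc_eq:
  "middle_thirds (Suc n) 0 l
     = (\<lambda>x. x / 3) ` middle_thirds n 0 l \<union> (\<lambda>x. x / 3 + 2 * l / 3) ` middle_thirds n 0 l"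
proof -
  have "l - l / 3 = 1 / 3 * 0 + 2 * l / 3" and "l = 1 / 3 * l + 2 * l / 3" by simp_all
  then have "middle_thirds n (l - l / 3) l = (\<lambda>x. 1 / 3 * x + 2 * l / 3) ` middle_thirds n 0 l"
    using middle_thirds_affine[of "1/3" n 0 "2 * l / 3" l] by simp
  moreover have "middle_thirds n 0 (l / 3) = (\<lambda>x. x / 3) ` middle_thirds n 0 l"
    using middle_thirds_affine[of "1/3" n 0 0 l] by simp
  ultimately show ?thesis by simp
qed

lemma compact_middle_thirds: "compact (middle_thirds n a b)"
  by (induction n arbitrary: a b) auto

lemma endpoint_in_middle_thirds: "a \<le> b \<Longrightarrow> a \<in> middle_thirds n a b"
  by (induction n arbitrary: a b) auto

lemma middle_thirds_subset: "a \<le> b \<Longrightarrow> middle_thirds n a b \<subseteq> {a..b}"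
proof (induction n arbitrary: a b)
  case (Suc n)
  have "middle_thirds n a (a + (b - a) / 3) \<subseteq> {a..a + (b - a) / 3}"
    and "middle_thirds n (b - (b - a) / 3) b \<subseteq> {b - (b - a) / 3..b}"
    using Suc.prems by (intro Suc.IH; simp)+
  moreover have "{a..a + (b - a) / 3} \<subseteq> {a..b}" "{b - (b - a) / 3..b} \<subseteq> {a..b}"
    using Suc.prems by (auto simp: field_simps)
  ultimately show ?case by auto
qed simp

lemma middle_thirds_mono: "a \<le> b \<Longrightarrow> middle_thirds (Suc n) a b \<subseteq> middle_thirds n a b"
proof (induction n arbitrary: a b)
  case 0
  then show ?case using middle_thirds_subset[of a b "Suc 0"] by simp
next
  case (Suc n)
  show ?case
    using Suc.IH[of a "a + (b - a) / 3"] Suc.IH[of "b - (b - a) / 3" b] Suc.prems by auto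
qed

lemma compact_cantor_set: "compact (cantor_set l)"
  unfolding cantor_set_def
  by (rule compact_Inter) (auto intro: compact_middle_thirds)

lemma zero_in_cantor_set: "l > 0 \<Longrightarrow> 0 \<in> cantor_set l"
  by (auto simp: cantor_set_def intro: endpoint_in_middle_thirds)

lemma cantor_set_self_similar:
  assumes "l > 0"
  shows "cantor_set l = (\<lambda>x. x / 3) ` cantor_set l \<union> (\<lambda>x. x / 3 + 2 * l / 3) ` cantor_set l"
proof (intro equalityI subsetI)
  fix x assume "x \<in> (\<lambda>x. x / 3) ` cantor_set l \<union> (\<lambda>x. x / 3 + 2 * l / 3) ` cantor_set l"
  then have S: "x \<in> middle_thirds (Suc n) 0 l" for n
    unfolding middle_thirds_Suc_eq cantor_set_def by blast
  have "x \<in> middle_thirds n 0 l" for n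
    using S[of n] middle_thirds_mono[of 0 l n] assms by auto
  then show "x \<in> cantor_set l" by (simp add: cantor_set_def)
next
  fix x assume x: "x \<in> cantor_set l"
  have sub: "middle_thirds n 0 l \<subseteq> {0..l}" for n using middle_thirds_subset assms by simp
  have S: "x \<in> middle_thirds (Suc n) 0 l" for n
    using x unfolding cantor_set_def by blast
  show "x \<in> (\<lambda>x. x / 3) ` cantor_set l \<union> (\<lambda>x. x / 3 + 2 * l / 3) ` cantor_set l"
  proof (cases "x \<le> l / 3")
    case True
    have "3 * x \<in> middle_thirds n 0 l" for n
      using S[of n] sub[of n] True assms unfolding middle_thirds_Suc_eq by fastforce
    then have "3 * x \<in> cantor_set l" by (simp add: cantor_set_def)
    then have "x \<in> (\<lambda>x. x / 3) ` cantor_set l" by (intro image_eqI[of _ _ "3 * x"]) auto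
    then show ?thesis by blast
  next
    case False
    have "3 * x - 2 * l \<in> middle_thirds n 0 l" for n
      using S[of n] sub[of n] False assms unfolding middle_thirds_Suc_eq
      by (fastforce simp: field_simps)
    then have "3 * x - 2 * l \<in> cantor_set l" by (simp add: cantor_set_def)
    then have "x \<in> (\<lambda>x. x / 3 + 2 * l / 3) ` cantor_set l"
      by (intro image_eqI[of _ _ "3 * x - 2 * l"]) (auto simp: field_simps)
    then show ?thesis by blast
  qed
qed

lemma cantor_set_unique:
  assumes l: "l > 0" and K: "compact K" "K \<noteq> {}"
    and eq: "K = (\<lambda>x. x / 3) ` K \<union> (\<lambda>x. x / 3 + 2 * l / 3) ` K"
  shows "K = cantor_set l"
proof (intro equalityI)
  obtain s where s: "s \<in> K" "\<And>x. x \<in> K \<Longrightarrow> x \<le> s" using compact_attains_sup[OF K] by blast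
  obtain i where i: "i \<in> K" "\<And>x. x \<in> K \<Longrightarrow> i \<le> x" using compact_attains_inf[OF K] by blast
  have "s / 3 + 2 * l / 3 \<in> K" "i / 3 \<in> K" using s i eq by blast+
  have img: "x / 3 \<in> K \<and> x / 3 + 2 * l / 3 \<in> K" if "x \<in> K" for x using that eq by blast
  have inv: "\<exists>y\<in>K. x = y / 3 \<or> x = y / 3 + 2 * l / 3" if "x \<in> K" for x using that eq by blast
  have K0: "K \<subseteq> {0..l}"
  proof -
    obtain y where "y \<in> K" "s = y / 3 \<or> s = y / 3 + 2 * l / 3" using inv[OF s(1)] by blast
    then have "s \<le> l" using s(2)[of y] l by auto
    obtain z where "z \<in> K" "i = z / 3 \<or> i = z / 3 + 2 * l / 3" using inv[OF i(1)] by blast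
    then have "0 \<le> i" using i(2)[of z] l by auto
    then show ?thesis using s(2) i(2) \<open>s \<le> l\<close> by fastforce
  qed
  have "K \<subseteq> middle_thirds n 0 l" for n
  proof (induction n)
    case 0
    show ?case using K0 by simp
  next
    case (Suc n)
    then show ?case unfolding middle_thirds_Suc_eq using eq by blast
  qed
  then show "K \<subseteq> cantor_set l" by (auto simp: cantor_set_def)
  have near: "\<exists>y\<in>K. \<bar>x - y\<bar> \<le> l / 3 ^ n" if "x \<in> middle_thirds n 0 l" for n x
    using that
  proof (induction n arbitrary: x)
    case 0
    have "0 \<le> s" "s \<le> l" using K0 s(1) by auto
    then have "\<bar>x - s\<bar> \<le> l" using 0 by (simp add: abs_le_iff)
    then show ?case using s(1) by auto
  next
    case (Suc n)
    obtain u where u: "u \<in> middle_thirds n 0 l" "x = u / 3 \<or> x = u / 3 + 2 * l / 3"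
      using Suc.prems unfolding middle_thirds_Suc_eq by blast
    obtain y where y: "y \<in> K" "\<bar>u - y\<bar> \<le> l / 3 ^ n" using Suc.IH[OF u(1)] by blast
    have *: "\<bar>u - y\<bar> / 3 \<le> l / 3 ^ Suc n" using y(2) by (simp add: field_simps)
    from u(2) show ?case
    proof
      assume "x = u / 3"
      then have "x - y / 3 = (u - y) / 3" by simp
      then have "\<bar>x - y / 3\<bar> \<le> l / 3 ^ Suc n" using * by (simp only: abs_divide abs_numeral)
      then show ?case using img[OF y(1)] by blast
    next
      assume "x = u / 3 + 2 * l / 3"
      then have "x - (y / 3 + 2 * l / 3) = (u - y) / 3" by simp
      then have "\<bar>x - (y / 3 + 2 * l / 3)\<bar> \<le> l / 3 ^ Suc n" using * by (simp only: abs_divide abs_numeral)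
      then show ?case using img[OF y(1)] by blast
    qed
  qed
  show "cantor_set l \<subseteq> K"
  proof
    fix x assume x: "x \<in> cantor_set l"
    have "x \<in> closure K" unfolding closure_approachable
    proof (intro allI impI)
      fix e :: real assume "0 < e"
      then obtain n where n: "(1 / 3) ^ n < e / l"
        using real_arch_pow_inv[of "e / l" "1/3"] l by auto
      then have "l / 3 ^ n < e" using l by (simp add: field_simps power_one_over)
      moreover obtain y where "y \<in> K" "\<bar>x - y\<bar> \<le> l / 3 ^ n"
        using near[of x n] x by (auto simp: cantor_set_def)
      ultimately show "\<exists>y\<in>K. dist y x < e" by (force simp: dist_real_def)
    qed
    then show "x \<in> K" using compact_imp_closed[OF K(1)] by simp
  qed
qed


section \<open>The functions \<open>p\<close> and \<open>q\<^sub>2\<close>\<close>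

definition cantor_p :: "real \<Rightarrow> real" where
  "cantor_p l = 1 / 2 * (\<Sum>\<^sub>\<infinity>i\<in>(UNIV :: int set). 2 powi i * tanh (l / (2 * 3 powi i)))"

definition cantor_q2 :: "real \<Rightarrow> real" where
  "cantor_q2 l = 1 - 1 / 2 * (\<Sum>i::nat. 1 / 2 ^ i * tanh (3 ^ i * l / 2))"

lemma tanh_le_self:
  fixes x :: real
  assumes "x \<ge> 0"
  shows "tanh x \<le> x"
proof -
  have "0 - tanh 0 \<le> x - tanh x"
  proof (rule DERIV_nonneg_imp_nondecreasing[OF assms])
    fix y :: real
    have "((\<lambda>x. x - tanh x) has_real_derivative 1 - (1 - tanh y ^ 2)) (at y)"
      by (auto intro!: derivative_eq_intros)
    then show "\<exists>d. ((\<lambda>x. x - tanh x) has_real_derivative d) (at y) \<and> 0 \<le> d"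
      by (intro exI conjI) auto
  qed
  then show ?thesis by simp
qed

lemma cantor_p_summable:
  assumes l: "l > 0"
  shows "(\<lambda>i::int. (2::real) powi i * tanh (l / (2 * 3 powi i))) summable_on UNIV"
proof -
  let ?f = "\<lambda>i::int. (2::real) powi i * tanh (l / (2 * 3 powi i))"
  have "summable (\<lambda>n. ?f (int n))"
  proof (rule summable_comparison_test')
    show "summable (\<lambda>n. l / 2 * (2 / 3) ^ n)" by (intro summable_mult summable_geometric) simp
    fix n :: nat
    have "tanh (l / (2 * 3 ^ n)) \<le> l / (2 * 3 ^ n)" using l by (intro tanh_le_self) simp
    then have "2 ^ n * tanh (l / (2 * 3 ^ n)) \<le> 2 ^ n * (l / (2 * 3 ^ n))"
      by (intro mult_left_mono) auto
    then show "norm (?f (int n)) \<le> l / 2 * (2 / 3) ^ n"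
      using l by (simp add: field_simps abs_mult)
  qed
  then have "(\<lambda>n. ?f (int n)) summable_on UNIV"
    using l by (subst summable_on_UNIV_nonneg_real_iff) (auto simp: abs_mult)
  then have 1: "?f summable_on range int"
    by (subst summable_on_reindex) (auto simp: o_def)
  have "summable (\<lambda>n. ?f (- int n - 1))"
  proof (rule summable_comparison_test')
    show "summable (\<lambda>n. (1 / 2 :: real) ^ n)" by (intro summable_geometric) simp
    fix n :: nat
    have "?f (- int n - 1) \<le> 2 powi (- int n - 1)"
      using less_imp_le[OF tanh_real_lt_1] by (intro mult_right_le_one_le) (use l in auto)
    also have "\<dots> \<le> 2 powi (- int n)" by (intro power_int_increasing) auto
    also have "\<dots> = (1 / 2 :: real) ^ n" by (simp add: power_int_minus power_one_over inverse_eq_divide)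
    finally show "norm (?f (- int n - 1)) \<le> (1 / 2) ^ n" using l by (simp add: abs_mult)
  qed
  then have "(\<lambda>n. ?f (- int n - 1)) summable_on UNIV"
    using l by (subst summable_on_UNIV_nonneg_real_iff) (auto simp: abs_mult)
  then have 2: "?f summable_on range (\<lambda>n. - int n - 1)"
    by (subst summable_on_reindex) (auto simp: o_def inj_on_def)
  have "i \<in> range int \<union> range (\<lambda>n. - int n - 1)" for i :: int
  proof (cases "i \<ge> 0")
    case True
    then show ?thesis by (intro UnI1 image_eqI[of _ _ "nat i"]) auto
  next
    case False
    then show ?thesis by (intro UnI2 image_eqI[of _ _ "nat (- i - 1)"]) auto
  qed
  then have U: "range int \<union> range (\<lambda>n. - int n - 1) = UNIV" by blast
  have "?f summable_on (range int \<union> range (\<lambda>n. - int n - 1))"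
    by (rule summable_on_Un_disjoint[OF 1 2]) auto
  then show ?thesis unfolding U .
qed

lemma cantor_q2_summable: "summable (\<lambda>i::nat. 1 / 2 ^ i * tanh (3 ^ i * l / 2) :: real)"
proof (rule summable_comparison_test')
  show "summable (\<lambda>n. (1 / 2 :: real) ^ n)" by (intro summable_geometric) simp
  fix n :: nat
  have "\<bar>tanh (3 ^ n * l / 2)\<bar> \<le> 1"
    using tanh_real_lt_1[of "3 ^ n * l / 2"] tanh_real_gt_neg1[of "3 ^ n * l / 2"] by linarith
  then show "norm (1 / 2 ^ n * tanh (3 ^ n * l / 2)) \<le> (1 / 2) ^ n"
    by (simp add: abs_mult power_one_over divide_right_mono)
qed

end

theory Submission
  imports Defs "HOL-Real_Asymp.Real_Asymp"
begin

text \<open>For points on the line, \<open>|A \<union> B| = |A| + |B| - 1 + tanh (g / 2)\<close> when \<open>B\<close> lies to the right of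
  \<open>A\<close> at distance \<open>g\<close>. Together with monotonicity (from positive definiteness) and self-similarity
  this gives \<open>|T\<^sub>l| = 2 |T\<^bsub>l/3\<^esub>| - 1 + tanh (l / 6)\<close>. The function \<open>p + q\<^sub>2\<close> satisfies the same
  recursion, and both functions take values in \<open>[1, 1 + l / 2]\<close>. Their difference \<open>D\<close> therefore satisfies
  \<open>|D l| = 2 ^ n |D (l / 3 ^ n)| \<le> (2 / 3) ^ n l / 2\<close> for all \<open>n\<close>, so it vanishes. For uniqueness,
  two candidates for \<open>p\<close> differ by a function \<open>d\<close> with \<open>d (3 ^ n l) = 2 ^ n d l\<close> that tends to \<open>0\<close>
  at infinity.\<close>

section \<open>Magnitude of finite subsets of the line\<close>

text \<open>Extend the weighting \<open>v\<close> of \<open>V\<close> by zero to \<open>u\<close> on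
  \<open>W\<close>. The quadratic form of the kernel \<open>exp (- dist x y)\<close> at
  \<open>w - u\<close> then equals the difference of the two magnitudes, and positive definiteness
  makes it nonnegative.\<close>

lemma finite_magnitude_mono:
  fixes V W :: "real set"
  assumes "finite W" "V \<subseteq> W"
  shows "finite_magnitude V \<le> finite_magnitude W"
proof -
  have V: "finite V" using assms finite_subset by blast
  obtain v where v: "is_weighting V v" using exists_weighting_real V by blast
  obtain w where w: "is_weighting W w" using exists_weighting_real assms by blast
  define u where "u = (\<lambda>x. if x \<in> V then v x else 0)"
  let ?Z = "\<lambda>x y :: real. exp (- dist x y)"
  have sumu: "(\<Sum>x\<in>W. f x * u x) = (\<Sum>x\<in>V. f x * v x)" for f :: "real \<Rightarrow> real"
  proof -
    have "(\<Sum>x\<in>W. f x * u x) = (\<Sum>x\<in>V. f x * u x)"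
      using assms by (intro sum.mono_neutral_right) (auto simp: u_def)
    then show ?thesis by (simp add: u_def)
  qed
  have w1: "(\<Sum>y\<in>W. ?Z x y * w y) = 1" if "x \<in> W" for x
    using w that by (simp add: is_weighting_def)
  have v1: "(\<Sum>y\<in>W. ?Z x y * u y) = 1" if "x \<in> V" for x
    using v that by (simp add: is_weighting_def sumu)
  have inner: "(\<Sum>y\<in>W. c * ?Z x y * (w y - u y)) =
      c * ((\<Sum>y\<in>W. ?Z x y * w y) - (\<Sum>y\<in>W. ?Z x y * u y))" for c x
    by (simp add: sum_distrib_left sum_subtractf algebra_simps)
  \<comment> \<open>Symmetry of the kernel lets it act on \<open>w\<close> instead of
    \<open>u\<close>, where it gives 1 at every point of \<open>W\<close>.\<close>
  have wu: "(\<Sum>x\<in>W. w x * (\<Sum>y\<in>W. ?Z x y * u y)) = (\<Sum>x\<in>V. v x)"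
  proof -
    have "(\<Sum>x\<in>W. w x * (\<Sum>y\<in>W. ?Z x y * u y)) = (\<Sum>x\<in>W. \<Sum>y\<in>W. ?Z x y * w x * u y)"
      by (simp add: sum_distrib_left mult_ac)
    also have "\<dots> = (\<Sum>y\<in>W. \<Sum>x\<in>W. ?Z x y * w x * u y)" by (rule sum.swap)
    also have "\<dots> = (\<Sum>y\<in>W. (\<Sum>x\<in>W. ?Z y x * w x) * u y)"
      by (simp add: sum_distrib_left sum_distrib_right mult_ac dist_commute)
    also have "\<dots> = (\<Sum>y\<in>W. 1 * u y)" using w1 by simp
    finally show ?thesis using sumu[of "\<lambda>_. 1"] by simp
  qed
  have "0 \<le> (\<Sum>x\<in>W. \<Sum>y\<in>W. (w x - u x) * ?Z x y * (w y - u y))"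
  proof (cases "\<exists>x\<in>W. w x - u x \<noteq> 0")
    case True
    then have "0 < (\<Sum>x\<in>W. \<Sum>y\<in>W. (w x - u x) * ?Z x y * (w y - u y))"
      using positive_definite_real[of W, unfolded positive_definite_def, rule_format,
          of W "\<lambda>x. w x - u x"] assms by simp
    then show ?thesis by simp
  qed simp
  also have "\<dots> = (\<Sum>x\<in>W. (w x - u x) * (1 - (\<Sum>y\<in>W. ?Z x y * u y)))"
    unfolding inner using w1 by (intro sum.cong) auto
  also have "\<dots> = (\<Sum>x\<in>W. w x) - (\<Sum>x\<in>W. w x * (\<Sum>y\<in>W. ?Z x y * u y))
      - (\<Sum>x\<in>W. (1 - (\<Sum>y\<in>W. ?Z x y * u y)) * u x)"
    by (simp add: algebra_simps sum_subtractf sum.distrib)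
  \<comment> \<open>\<open>u\<close> is supported on \<open>V\<close>, and there the other factor
    vanishes by \<open>v1\<close>.\<close>
  also have "(\<Sum>x\<in>W. (1 - (\<Sum>y\<in>W. ?Z x y * u y)) * u x) = 0"
    unfolding sumu using v1 by (intro sum.neutral) (auto simp: sumu)
  also have "(\<Sum>x\<in>W. w x) - (\<Sum>x\<in>W. w x * (\<Sum>y\<in>W. ?Z x y * u y)) - 0 =
      finite_magnitude W - finite_magnitude V"
    unfolding wu finite_magnitude_eq[OF w] finite_magnitude_eq[OF v] by simp
  finally show ?thesis by simp
qed

lemma finite_magnitude_empty [simp]: "finite_magnitude {} = 0"
  using finite_magnitude_eq[of "{}" "\<lambda>_. 0"] by (simp add: is_weighting_def)

lemma finite_magnitude_singleton [simp]: "finite_magnitude {x} = 1"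
  using finite_magnitude_eq[of "{x}" "\<lambda>_. 1"] by (simp add: is_weighting_def)

lemma finite_magnitude_translate:
  fixes W :: "real set"
  assumes "finite W"
  shows "finite_magnitude ((\<lambda>x. x + c) ` W) = finite_magnitude W"
proof -
  obtain w where w: "is_weighting W w" using exists_weighting_real assms by blast
  have "is_weighting ((\<lambda>x. x + c) ` W) (\<lambda>x. w (x - c))"
    using w by (simp add: is_weighting_def sum.reindex)
  from finite_magnitude_eq[OF this] show ?thesis
    by (simp add: sum.reindex finite_magnitude_eq[OF w])
qed

text \<open>Brings the gap term into the form \<open>1 - 2 * c\<close>, with \<open>c\<close> the
  correction made when two weightings are glued.\<close>

lemma tanh_half_exp: "tanh (x / 2) = 1 - 2 * (exp (- x) / (1 + exp (- x)))" for x :: real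
  using tanh_real_altdef[of "x / 2"] by (simp add: field_simps add_pos_pos[THEN less_imp_neq, symmetric])

text \<open>Any distance across the gap splits at \<open>a\<close> and \<open>b\<close>, so the
  kernel factors there. Hence each set influences the other only through its end point, and lowering
  the weights at \<open>a\<close> and \<open>b\<close> by a common \<open>c\<close> turns the two
  weightings into one of the union.\<close>

lemma finite_magnitude_Un_gap:
  fixes A B :: "real set"
  assumes fin: "finite A" "finite B" and "a < b"
    and A: "a \<in> A" "\<And>x. x \<in> A \<Longrightarrow> x \<le> a" and B: "b \<in> B" "\<And>x. x \<in> B \<Longrightarrow> b \<le> x"
  shows "finite_magnitude (A \<union> B) =
    finite_magnitude A + finite_magnitude B - 1 + tanh ((b - a) / 2)"
proof -
  obtain v where v: "is_weighting A v" using exists_weighting_real fin by blast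
  obtain w where w: "is_weighting B w" using exists_weighting_real fin by blast
  have disj: "A \<inter> B = {}" using A B \<open>a < b\<close> by force
  define r where "r = exp (- dist a b)"
  \<comment> \<open>Seen from a point of \<open>A\<close>, the set \<open>B\<close> contributes
    \<open>r * (1 - c)\<close> and \<open>A\<close> loses \<open>c\<close>, both times the same
    factor \<open>exp (- dist x a)\<close>. They cancel when \<open>c + c * r = r\<close>.\<close>
  define c where "c = r / (1 + r)"
  have "r > 0" by (simp add: r_def)
  then have "c * (1 + r) = r" unfolding c_def by (intro nonzero_eq_divide_eq[THEN iffD1]) auto
  then have c: "c + c * r = r" by (simp add: distrib_left)
  define u where "u = (\<lambda>x. if x \<in> A then v x - (if x = a then c else 0)
    else w x - (if x = b then c else 0))"
  have sumA: "(\<Sum>x\<in>A. f x * u x) = (\<Sum>x\<in>A. f x * v x) - f a * c" for f :: "real \<Rightarrow> real"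
  proof -
    have "(\<Sum>x\<in>A. f x * u x) = (\<Sum>x\<in>A. f x * v x - (if x = a then f a * c else 0))"
      by (intro sum.cong) (auto simp: u_def algebra_simps)
    then show ?thesis using A fin by (simp add: sum_subtractf)
  qed
  have sumB: "(\<Sum>x\<in>B. f x * u x) = (\<Sum>x\<in>B. f x * w x) - f b * c" for f :: "real \<Rightarrow> real"
  proof -
    have "(\<Sum>x\<in>B. f x * u x) = (\<Sum>x\<in>B. f x * w x - (if x = b then f b * c else 0))"
      using disj by (intro sum.cong) (auto simp: u_def algebra_simps)
    then show ?thesis using B fin by (simp add: sum_subtractf)
  qed
  have un: "(\<Sum>x\<in>A \<union> B. f x * u x) =
      (\<Sum>x\<in>A. f x * v x) - f a * c + ((\<Sum>x\<in>B. f x * w x) - f b * c)" for f :: "real \<Rightarrow> real"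
    using fin disj by (simp add: sum.union_disjoint sumA sumB)
  have vA: "(\<Sum>y\<in>A. exp (- dist x y) * v y) = 1" if "x \<in> A" for x
    using v that by (simp add: is_weighting_def)
  have wB: "(\<Sum>y\<in>B. exp (- dist x y) * w y) = 1" if "x \<in> B" for x
    using w that by (simp add: is_weighting_def)
  have "(\<Sum>y\<in>A \<union> B. exp (- dist x y) * u y) = 1" if "x \<in> A" for x
  proof -
    have xb: "exp (- dist x y) = exp (- dist x a) * r * exp (- dist b y)" if "y \<in> B" for y
      using exp_dist_insert_real[of x a y] exp_dist_insert_real[of a b y]
        A(2)[OF \<open>x \<in> A\<close>] B(2)[OF that] \<open>a < b\<close> by (simp add: r_def)
    have "(\<Sum>y\<in>B. exp (- dist x y) * w y) = exp (- dist x a) * r * (\<Sum>y\<in>B. exp (- dist b y) * w y)"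
      unfolding sum_distrib_left using xb by (intro sum.cong) auto
    then show ?thesis
      unfolding un using vA[OF that] wB[OF B(1)] xb[OF B(1)] c by simp algebra
  qed
  moreover have "(\<Sum>y\<in>A \<union> B. exp (- dist x y) * u y) = 1" if "x \<in> B" for x
  proof -
    have xa: "exp (- dist x y) = exp (- dist x b) * r * exp (- dist a y)" if "y \<in> A" for y
      using exp_dist_insert_real[of y a x] exp_dist_insert_real[of a b x]
        B(2)[OF \<open>x \<in> B\<close>] A(2)[OF that] \<open>a < b\<close> by (simp add: r_def dist_commute)
    have "(\<Sum>y\<in>A. exp (- dist x y) * v y) = exp (- dist x b) * r * (\<Sum>y\<in>A. exp (- dist a y) * v y)"
      unfolding sum_distrib_left using xa by (intro sum.cong) auto
    then show ?thesis
      unfolding un using wB[OF that] vA[OF A(1)] xa[OF A(1)] c by simp algebra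
  qed
  ultimately have "is_weighting (A \<union> B) u" by (auto simp: is_weighting_def)
  then have "finite_magnitude (A \<union> B) = finite_magnitude A + finite_magnitude B - 2 * c"
    using un[of "\<lambda>_. 1"] by (simp add: finite_magnitude_eq[OF v] finite_magnitude_eq[OF w]
        finite_magnitude_eq)
  moreover have "tanh ((b - a) / 2) = 1 - 2 * c"
    using \<open>a < b\<close> unfolding tanh_half_exp by (simp add: c_def r_def dist_real_def)
  ultimately show ?thesis by simp
qed

text \<open>Adding points from left to right, each new point at gap \<open>g\<close> contributes
  \<open>tanh (g / 2)\<close>, at most \<open>g / 2\<close>, and the gaps add up to at most
  \<open>b - a\<close>.\<close>

lemma finite_magnitude_le:
  fixes W :: "real set"
  assumes "finite W" "W \<subseteq> {a..b}" "a \<le> b"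
  shows "finite_magnitude W \<le> 1 + (b - a) / 2"
  using assms
\<comment> \<open>The right end must vary: the hypothesis is applied with the maximum of
  \<open>W\<close> in place of \<open>b\<close>.\<close>
proof (induction W arbitrary: b rule: finite_linorder_max_induct)
  case empty
  then show ?case by simp
next
  case (insert m W)
  show ?case
  proof (cases "W = {}")
    case True
    then show ?thesis using insert.prems by simp
  next
    case False
    define M where "M = Max W"
    have M: "M \<in> W" "\<And>x. x \<in> W \<Longrightarrow> x \<le> M"
      using insert False by (auto simp: M_def)
    have Mm: "M < m" "a \<le> M" "m \<le> b" using insert M by auto
    have "finite_magnitude (W \<union> {m}) = finite_magnitude W + 1 - 1 + tanh ((m - M) / 2)"
      using finite_magnitude_Un_gap[of W "{m}" M m] M Mm insert.hyps by simp
    moreover have "finite_magnitude W \<le> 1 + (M - a) / 2"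
      using insert.prems M Mm by (intro insert.IH) auto
    moreover have "tanh ((m - M) / 2) \<le> (m - M) / 2"
      using Mm by (intro tanh_le_self) simp
    ultimately show ?thesis using Mm by (simp add: field_simps)
  qed
qed


section \<open>Magnitude of the Cantor set\<close>

text \<open>A real-valued form of the magnitude, so that the recursion is plain real arithmetic. For
  \<open>l > 0\<close> the supremum is over a set bounded by \<open>1 + l / 2\<close>.\<close>

definition cantor_mag :: "real \<Rightarrow> real" where
  "cantor_mag l = (SUP W\<in>{W. finite W \<and> W \<subseteq> cantor_set l}. finite_magnitude W)"

lemma cantor_set_subset: "l > 0 \<Longrightarrow> cantor_set l \<subseteq> {0..l}"
  unfolding cantor_set_def using middle_thirds.simps(1)[of 0 l] by blast

lemma right_end_in_cantor_set:
  assumes "l > 0"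
  shows "l \<in> cantor_set l"
proof -
  have "a \<le> b \<Longrightarrow> b \<in> middle_thirds n a b" for n and a b :: real
    by (induction n arbitrary: a b) auto
  then show ?thesis using assms by (simp add: cantor_set_def)
qed

lemma cantor_set_third: "(\<lambda>x. x / 3) ` cantor_set l = cantor_set (l / 3)"
proof -
  have "middle_thirds n 0 (l / 3) = (\<lambda>x. x / 3) ` middle_thirds n 0 l" for n
    using middle_thirds_affine[of "1/3" n 0 0 l] by simp
  then show ?thesis
    unfolding cantor_set_def by (subst image_INT[of _ UNIV]) (auto simp: inj_on_def)
qed

lemma cantor_set_eq_Un:
  assumes "l > 0"
  shows "cantor_set l = cantor_set (l / 3) \<union> (\<lambda>x. x + 2 * l / 3) ` cantor_set (l / 3)"
  using cantor_set_self_similar[OF assms] unfolding cantor_set_third[symmetric] image_image .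

lemma finite_magnitude_le_cantor_mag:
  assumes "l > 0" "finite W" "W \<subseteq> cantor_set l"
  shows "finite_magnitude W \<le> cantor_mag l"
  unfolding cantor_mag_def
proof (rule cSUP_upper)
  show "bdd_above (finite_magnitude ` {W. finite W \<and> W \<subseteq> cantor_set l})"
    using assms(1) cantor_set_subset[OF assms(1)]
    by (intro bdd_aboveI2[where M = "1 + l / 2"])
      (use finite_magnitude_le[of _ 0 l] in force)
qed (use assms in auto)

lemma cantor_mag_least:
  assumes "\<And>W. finite W \<Longrightarrow> W \<subseteq> cantor_set l \<Longrightarrow> finite_magnitude W \<le> c"
  shows "cantor_mag l \<le> c"
  unfolding cantor_mag_def using assms by (intro cSUP_least) auto

lemma magnitude_cantor_set:
  assumes "l > 0"
  shows "magnitude (cantor_set l) = ereal (cantor_mag l)"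
  unfolding magnitude_def
proof (rule SUP_eqI)
  fix y assume y: "\<And>W. W \<in> {W. finite W \<and> W \<subseteq> cantor_set l} \<Longrightarrow> ereal (finite_magnitude W) \<le> y"
  show "ereal (cantor_mag l) \<le> y"
  proof (cases y)
    case (real r)
    then show ?thesis using y by (auto intro: cantor_mag_least)
  next
    \<comment> \<open>The empty subset has magnitude 0, which excludes this value.\<close>
    case MInf
    then show ?thesis using y[of "{}"] by simp
  qed simp
qed (use assms finite_magnitude_le_cantor_mag in auto)

lemma cantor_mag_bounds:
  assumes "l > 0"
  shows "1 \<le> cantor_mag l" "cantor_mag l \<le> 1 + l / 2"
proof -
  show "1 \<le> cantor_mag l"
    using finite_magnitude_le_cantor_mag[of l "{0}"] zero_in_cantor_set assms by simp
  show "cantor_mag l \<le> 1 + l / 2"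
    using assms cantor_set_subset[OF assms] finite_magnitude_le[of _ 0 l]
    by (intro cantor_mag_least) force
qed

text \<open>The set consists of two copies of the Cantor set of length \<open>l / 3\<close>,
  separated by a gap of length \<open>l / 3\<close>. Finite subsets are enlarged to contain the ends
  of the gap; the gluing formula then applies, and monotonicity keeps the estimates in the right
  direction.\<close>

lemma cantor_mag_rec:
  assumes l: "l > 0"
  shows "cantor_mag l = 2 * cantor_mag (l / 3) - 1 + tanh (l / 6)"
proof (rule antisym)
  let ?C = "cantor_set (l / 3)" and ?h = "\<lambda>x. x + 2 * l / 3"
  have sub: "?C \<subseteq> {0..l / 3}" using cantor_set_subset l by simp
  have ends: "0 \<in> ?C" "l / 3 \<in> ?C" using zero_in_cantor_set right_end_in_cantor_set l by simp_all
  have gap: "finite_magnitude (A \<union> ?h ` B)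
      = finite_magnitude A + finite_magnitude B - 1 + tanh (l / 6)"
    if "finite A" "finite B" "A \<subseteq> ?C" "B \<subseteq> ?C" "l / 3 \<in> A" "0 \<in> B" for A B
  proof -
    have "finite_magnitude (A \<union> ?h ` B)
        = finite_magnitude A + finite_magnitude (?h ` B) - 1 + tanh ((2 * l / 3 - l / 3) / 2)"
      using that sub l by (intro finite_magnitude_Un_gap) force+
    also have "(2 * l / 3 - l / 3) / 2 = l / 6" by simp
    finally show ?thesis using that by (simp only: finite_magnitude_translate)
  qed
  show "cantor_mag l \<le> 2 * cantor_mag (l / 3) - 1 + tanh (l / 6)"
  proof (rule cantor_mag_least)
    fix W assume W: "finite W" "W \<subseteq> cantor_set l"
    \<comment> \<open>The left and right parts of \<open>W\<close>, the right one pulled back along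
      \<open>?h\<close>, each with its end of the gap adjoined.\<close>
    define A where "A = insert (l / 3) (W \<inter> ?C)"
    define B where "B = insert 0 (?h -` W \<inter> ?C)"
    have fin: "finite A" "finite B"
      using W by (auto simp: A_def B_def intro!: finite_vimageI finite_Int inj_onI)
    have AB: "A \<subseteq> ?C" "B \<subseteq> ?C" "l / 3 \<in> A" "0 \<in> B" using ends by (auto simp: A_def B_def)
    have "W \<subseteq> A \<union> ?h ` B"
      using W(2) unfolding cantor_set_eq_Un[OF l] A_def B_def by fast
    then have "finite_magnitude W \<le> finite_magnitude (A \<union> ?h ` B)"
      using fin by (intro finite_magnitude_mono) auto
    also have "\<dots> = finite_magnitude A + finite_magnitude B - 1 + tanh (l / 6)"
      using gap fin AB by blast
    finally show "finite_magnitude W \<le> 2 * cantor_mag (l / 3) - 1 + tanh (l / 6)"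
      using finite_magnitude_le_cantor_mag[of "l / 3" A]
        finite_magnitude_le_cantor_mag[of "l / 3" B] fin AB l by simp
  qed
  \<comment> \<open>The lower bound is solved for \<open>cantor_mag (l / 3)\<close> so that it
    becomes an upper bound on a supremum.\<close>
  have "cantor_mag (l / 3) \<le> (cantor_mag l + 1 - tanh (l / 6)) / 2"
  proof (rule cantor_mag_least)
    fix V assume V: "finite V" "V \<subseteq> ?C"
    \<comment> \<open>Both end points are needed because \<open>A\<close> serves as the left part
      and, shifted, as the right part.\<close>
    define A where "A = insert 0 (insert (l / 3) V)"
    have A: "finite A" "A \<subseteq> ?C" "0 \<in> A" "l / 3 \<in> A" using V ends by (auto simp: A_def)
    have "finite_magnitude V \<le> finite_magnitude A"
      using A V by (intro finite_magnitude_mono) (auto simp: A_def)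
    moreover have "A \<union> ?h ` A \<subseteq> cantor_set l" using A cantor_set_eq_Un[OF l] by blast
    then have "finite_magnitude (A \<union> ?h ` A) \<le> cantor_mag l"
      using A l by (intro finite_magnitude_le_cantor_mag) auto
    then have "2 * finite_magnitude A - 1 + tanh (l / 6) \<le> cantor_mag l" using gap[of A A] A by simp
    ultimately show "finite_magnitude V \<le> (cantor_mag l + 1 - tanh (l / 6)) / 2" by simp
  qed
  then show "2 * cantor_mag (l / 3) - 1 + tanh (l / 6) \<le> cantor_mag l" by simp
qed


section \<open>The functions \<open>p\<close> and \<open>q\<^sub>2\<close>\<close>

text \<open>Shifting the index by one absorbs the factor 3 and releases a factor 2.\<close>

lemma cantor_p_3: "cantor_p (3 * l) = 2 * cantor_p l"
proof -
  let ?f = "\<lambda>l i. 2 powi i * tanh (l / (2 * 3 powi i)) :: real"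
  have "(\<Sum>\<^sub>\<infinity>i\<in>UNIV. ?f (3 * l) i) = (\<Sum>\<^sub>\<infinity>i\<in>UNIV. ?f (3 * l) (i + 1))"
    by (rule infsum_reindex_bij_betw[symmetric]) (rule bij_plus_right)
  also have "\<dots> = (\<Sum>\<^sub>\<infinity>i\<in>UNIV. 2 * ?f l i)"
    by (intro infsum_cong) (simp add: power_int_add mult_ac)
  also have "\<dots> = 2 * (\<Sum>\<^sub>\<infinity>i\<in>UNIV. ?f l i)" by (rule infsum_cmult_right')
  finally show ?thesis by (simp add: cantor_p_def)
qed

text \<open>Splitting off the term of index 0 gives the same recursion as
  \<open>cantor_mag_rec\<close>.\<close>

lemma cantor_q2_third: "cantor_q2 l = 2 * cantor_q2 (l / 3) - 1 + tanh (l / 6)"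
proof -
  have "(\<Sum>i. 1 / 2 ^ i * tanh (3 ^ i * (l / 3) / 2))
      = tanh (l / 6) + (\<Sum>i. 1 / 2 * (1 / 2 ^ i * tanh (3 ^ i * l / 2)))"
    using suminf_split_head[OF cantor_q2_summable[of "l / 3"]] by (simp add: field_simps)
  also have "\<dots> = tanh (l / 6) + 1 / 2 * (\<Sum>i. 1 / 2 ^ i * tanh (3 ^ i * l / 2))"
    by (subst suminf_mult[OF cantor_q2_summable]) simp
  finally show ?thesis by (simp add: cantor_q2_def field_simps)
qed

text \<open>The terms of \<open>cantor_p\<close> with index at most 0 cancel the series in
  \<open>cantor_q2\<close>. What remains is 1 plus half a series over positive indices, which is
  nonnegative and, by \<open>tanh_le_self\<close>, dominated by a geometric series with sum
  \<open>l\<close>.\<close>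

lemma cantor_p_q2_bounds:
  assumes l: "l > 0"
  shows "1 \<le> cantor_p l + cantor_q2 l" "cantor_p l + cantor_q2 l \<le> 1 + l / 2"
proof -
  let ?f = "\<lambda>i::int. (2::real) powi i * tanh (l / (2 * 3 powi i))"
  \<comment> \<open>Index 0 belongs to \<open>?neg\<close>, as the series of
    \<open>cantor_q2\<close> starts at 0.\<close>
  let ?pos = "\<lambda>n::nat. int n + 1" and ?neg = "\<lambda>n::nat. - int n"
  have summ: "?f summable_on S" for S
    using summable_on_subset_banach[OF cantor_p_summable[OF l]] by blast
  have nat: "infsum ?f (range g) = (\<Sum>n. ?f (g n)) \<and> summable (\<lambda>n. ?f (g n))"
    if "inj g" for g :: "nat \<Rightarrow> int"
  proof -
    have "(\<lambda>n. ?f (g n)) summable_on UNIV"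
      using summ[of "range g"] that by (simp add: summable_on_reindex o_def)
    then have "((\<lambda>n. ?f (g n)) has_sum infsum ?f (range g)) UNIV"
      using infsum_reindex[OF that, of ?f] by (simp add: o_def)
    then have "(\<lambda>n. ?f (g n)) sums infsum ?f (range g)" by (rule has_sum_imp_sums)
    then show ?thesis by (simp add: sums_iff)
  qed
  have inj: "inj ?pos" "inj ?neg" by (auto simp: inj_def)
  have "i \<in> range ?pos \<union> range ?neg" for i
  proof (cases "i > 0")
    case True
    then show ?thesis by (intro UnI1 image_eqI[of _ _ "nat (i - 1)"]) auto
  next
    case False
    then show ?thesis by (intro UnI2 image_eqI[of _ _ "nat (- i)"]) auto
  qed
  then have "UNIV = range ?pos \<union> range ?neg" by blast
  then have "infsum ?f UNIV = infsum ?f (range ?pos) + infsum ?f (range ?neg)"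
    using infsum_Un_disjoint[OF summ summ, of "range ?pos" "range ?neg"] by fastforce
  moreover have "?f (?neg n) = 1 / 2 ^ n * tanh (3 ^ n * l / 2)" for n
    by (simp add: power_int_minus field_simps)
  ultimately have eq: "cantor_p l + cantor_q2 l = 1 + 1 / 2 * (\<Sum>n. ?f (?pos n))"
    using nat[OF inj(1)] nat[OF inj(2)] by (simp add: cantor_p_def cantor_q2_def add_divide_distrib)
  have nonneg: "0 \<le> ?f (?pos n)" for n using l by simp
  show "1 \<le> cantor_p l + cantor_q2 l"
    unfolding eq using suminf_nonneg[OF _ nonneg] nat[OF inj(1)] by simp
  have bound: "?f (?pos n) \<le> l / 3 * (2 / 3) ^ n" for n
  proof -
    have "?f (?pos n) \<le> 2 powi ?pos n * (l / (2 * 3 powi ?pos n))"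
      using l by (intro mult_left_mono tanh_le_self) auto
    also have "\<dots> = l / 3 * (2 / 3) ^ n" by (simp add: power_int_add power_divide)
    finally show ?thesis .
  qed
  have "(\<lambda>n. l / 3 * (2 / 3) ^ n) sums (l / 3 * (1 / (1 - 2 / 3)))"
    by (intro sums_mult geometric_sums) simp
  then have geo: "(\<lambda>n. l / 3 * (2 / 3) ^ n) sums l" by simp
  have "(\<Sum>n. ?f (?pos n)) \<le> l"
    using sums_le[OF bound summable_sums geo] nat[OF inj(1)] by blast
  then show "cantor_p l + cantor_q2 l \<le> 1 + l / 2" unfolding eq by simp
qed

section \<open>Identification of the magnitude with the sum of the two functions\<close>

lemma cantor_mag_eq:
  assumes l: "l > 0"
  shows "cantor_mag l = cantor_p l + cantor_q2 l"
proof -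
  define D where "D l = cantor_mag l - (cantor_p l + cantor_q2 l)" for l
  \<comment> \<open>The inhomogeneous term \<open>- 1 + tanh (l / 6)\<close> is common to both
    recursions and drops out.\<close>
  have rec: "D l = 2 * D (l / 3)" if "l > 0" for l
    using cantor_mag_rec[OF that] cantor_q2_third[of l] cantor_p_3[of "l / 3"]
    by (simp add: D_def)
  have iter: "D l = 2 ^ n * D (l / 3 ^ n)" for n
  proof (induction n)
    case (Suc n)
    then show ?case using rec[of "l / 3 ^ n"] l by (simp add: mult_ac)
  qed simp
  have bound: "\<bar>D l\<bar> \<le> l / 2 * (2 / 3) ^ n" for n
  proof -
    have pos: "l / 3 ^ n > 0" using l by simp
    \<comment> \<open>Both quantities lie in an interval of length
      \<open>l / 3 ^ n / 2\<close>.\<close>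
    have "\<bar>D (l / 3 ^ n)\<bar> \<le> l / 3 ^ n / 2"
      using cantor_mag_bounds[OF pos] cantor_p_q2_bounds[OF pos] unfolding D_def by linarith
    then have "2 ^ n * \<bar>D (l / 3 ^ n)\<bar> \<le> 2 ^ n * (l / 3 ^ n / 2)" by (rule mult_left_mono) simp
    then show ?thesis using iter[of n] by (simp add: abs_mult power_divide field_simps)
  qed
  have "(\<lambda>n. l / 2 * (2 / 3) ^ n) \<longlonglongrightarrow> 0"
    by (intro tendsto_mult_right_zero LIMSEQ_power_zero) simp
  then have "\<bar>D l\<bar> \<le> 0" by (rule LIMSEQ_le_const) (use bound in blast)
  then show ?thesis by (simp add: D_def)
qed

section \<open>Decay at infinity\<close>

text \<open>Each \<open>tanh (3 ^ n * l / 2)\<close> lies between \<open>tanh (l / 2)\<close> and 1,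
  and the coefficients \<open>1 / 2 ^ n\<close> have sum 2.\<close>

lemma cantor_q2_bounds:
  assumes l: "l \<ge> 0"
  shows "0 \<le> cantor_q2 l" "cantor_q2 l \<le> 1 - tanh (l / 2)"
proof -
  have "(\<lambda>n. (1 / 2 :: real) ^ n) sums (1 / (1 - 1 / 2))" by (rule geometric_sums) simp
  then have geo: "(\<lambda>n. 1 / 2 ^ n :: real) sums 2" by (simp add: power_one_over)
  then have geo': "(\<lambda>n. 1 / 2 ^ n * tanh (l / 2)) sums (2 * tanh (l / 2))" by (rule sums_mult2)
  have "(\<Sum>n. 1 / 2 ^ n * tanh (3 ^ n * l / 2)) \<le> (\<Sum>n. 1 / 2 ^ n)"
    using geo cantor_q2_summable less_imp_le[OF tanh_real_lt_1]
    by (intro suminf_le) (auto simp: sums_iff divide_right_mono)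
  then show "0 \<le> cantor_q2 l" using geo by (simp add: cantor_q2_def sums_iff)
  have "(\<Sum>n. 1 / 2 ^ n * tanh (l / 2)) \<le> (\<Sum>n. 1 / 2 ^ n * tanh (3 ^ n * l / 2))"
  proof (intro suminf_le mult_left_mono)
    fix n :: nat
    have "1 * l \<le> 3 ^ n * l" using l by (intro mult_right_mono) auto
    then show "tanh (l / 2) \<le> tanh (3 ^ n * l / 2)" by simp
  qed (use geo' cantor_q2_summable in \<open>auto simp: sums_iff\<close>)
  then show "cantor_q2 l \<le> 1 - tanh (l / 2)" using geo' by (simp add: cantor_q2_def sums_iff)
qed

lemma cantor_q2_tendsto_0: "(cantor_q2 \<longlongrightarrow> 0) at_top"
proof (rule tendsto_sandwich)
  show "\<forall>\<^sub>F l in at_top. 0 \<le> cantor_q2 l" "\<forall>\<^sub>F l in at_top. cantor_q2 l \<le> 1 - tanh (l / 2)"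
    using eventually_ge_at_top[of 0] by (eventually_elim; simp add: cantor_q2_bounds)+
  have "filterlim (\<lambda>l::real. l / 2) at_top at_top"
    by real_asymp
  then have "((\<lambda>l::real. tanh (l / 2)) \<longlongrightarrow> 1) at_top"
    by (rule filterlim_compose[OF tanh_real_at_top])
  from tendsto_diff[OF tendsto_const[of 1] this]
  show "((\<lambda>l::real. 1 - tanh (l / 2)) \<longlongrightarrow> 0) at_top" by simp
qed auto

section \<open>Uniqueness of the decomposition\<close>

lemma cantor_decomposition_unique:
  fixes p q p' q' :: "real \<Rightarrow> real"
  assumes eq: "\<And>l. l > 0 \<Longrightarrow> p l + q l = p' l + q' l"
    and p: "\<And>l. l > 0 \<Longrightarrow> p (3 * l) = 2 * p l" and p': "\<And>l. l > 0 \<Longrightarrow> p' (3 * l) = 2 * p' l"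
    and q: "(q \<longlongrightarrow> 0) at_top" and q': "(q' \<longlongrightarrow> 0) at_top" and l: "l > 0"
  shows "p l = p' l"
proof -
  have iter: "2 ^ n * (p l - p' l) = p (3 ^ n * l) - p' (3 ^ n * l)" for n
  proof (induction n)
    case (Suc n)
    then show ?case using p[of "3 ^ n * l"] p'[of "3 ^ n * l"] l by (simp add: mult.assoc)
  qed simp
  \<comment> \<open>Equality of the sums trades the difference of \<open>p\<close> and
    \<open>p'\<close> at \<open>3 ^ n * l\<close> for that of \<open>q'\<close> and
    \<open>q\<close>, whose limit is known.\<close>
  have scale: "p l - p' l = (q' (3 ^ n * l) - q (3 ^ n * l)) * (1 / 2) ^ n" for n
  proof -
    have "2 ^ n * (p l - p' l) = q' (3 ^ n * l) - q (3 ^ n * l)"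
      using iter[of n] eq[of "3 ^ n * l"] l by simp
    then show ?thesis by (simp add: field_simps power_one_over)
  qed
  have lim: "filterlim (\<lambda>n. 3 ^ n * l) at_top sequentially" using l by real_asymp
  have "(\<lambda>n. (q' (3 ^ n * l) - q (3 ^ n * l)) * (1 / 2) ^ n) \<longlonglongrightarrow> (0 - 0) * 0"
    by (intro tendsto_mult tendsto_diff filterlim_compose[OF q lim] filterlim_compose[OF q' lim]
        LIMSEQ_power_zero) simp
  \<comment> \<open>Read backwards, \<open>scale\<close> shows that the convergent sequence is
    constant.\<close>
  then have "(\<lambda>n. p l - p' l) \<longlonglongrightarrow> 0" by (simp flip: scale)
  then show ?thesis by (simp add: LIMSEQ_const_iff)
qed

theorem theorem11:
  shows "(\<forall>l>0. magnitude (cantor_set l) = ereal (cantor_p l + cantor_q2 l))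
    \<and> (\<forall>l>0. cantor_p (3 * l) = 2 * cantor_p l)
    \<and> (cantor_q2 \<longlongrightarrow> 0) at_top
    \<and> (\<forall>p q :: real \<Rightarrow> real.
          (\<forall>l>0. magnitude (cantor_set l) = ereal (p l + q l)) \<and>
          (\<forall>l>0. p (3 * l) = 2 * p l) \<and>
          (q \<longlongrightarrow> 0) at_top
          \<longrightarrow> (\<forall>l>0. p l = cantor_p l \<and> q l = cantor_q2 l))"
proof (intro conjI allI impI)
  show mag: "magnitude (cantor_set l) = ereal (cantor_p l + cantor_q2 l)" if "l > 0" for l
    using magnitude_cantor_set[OF that] cantor_mag_eq[OF that] by simp
  fix p q :: "real \<Rightarrow> real" and l :: real
  assume *: "(\<forall>l>0. magnitude (cantor_set l) = ereal (p l + q l)) \<and>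
      (\<forall>l>0. p (3 * l) = 2 * p l) \<and> (q \<longlongrightarrow> 0) at_top" and l: "l > 0"
  \<comment> \<open>Both sums equal the magnitude, so they agree.\<close>
  have eq: "p l + q l = cantor_p l + cantor_q2 l" if "l > 0" for l
    using * mag[OF that] that by simp
  show "p l = cantor_p l"
    using * eq l cantor_p_3 cantor_q2_tendsto_0
    by (intro cantor_decomposition_unique[of p q cantor_p cantor_q2]) auto
  then show "q l = cantor_q2 l" using eq[OF l] by simp
qed (simp_all add: cantor_p_3 cantor_q2_tendsto_0)

end
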